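(* Let $\varepsilon\in(0,1)$ and $p=p(n)=\omega(\log n/n)$, where $n\in 2\mathbb{N}$ is sufficiently large. Let $G$ be a (single) sample of $G(n,p)$ on vertex set $V=[n]$. Then, whp, the following holds: for all spanning subgraphs $H_c\subseteq G$, $1\le c\le n/2$, with $\delta(H_c)\ge\left(\frac12+\varepsilon\right)np$ for every $c$, the family $\{H_1,\dots,H_{n/2}\}$ admits a rainbow perfect matching.
   Context: $[n]=\{1,\dots,n\}$. $G(n,p)$ is the binomial random graph on vertex set $[n]$: each unordered pair of vertices is an edge with probability $p$, independently. $\delta(H)$ denotes the minimum degree of $H$. $p=\omega(\log n/n)$ means $\frac{\log n/n}{p}\to0$ as $n\to\infty$. "Whp" (with high probability) means with probability tending to $1$ as $n\to\infty$ (here along even $n$). Rainbow: given a family $\{H_1,\ldots,H_m\}$ of not necessarily distinct graphs on the same vertex set $V$, a graph $F$ on $V$ is rainbow if there is an injection $\varphi:E(F)\to[m]$ such that $e\in E(H_{\varphi(e)})$ for every $e\in E(F)$. The family admits a rainbow perfect matching if some perfect matching $F$ on $V$ (a set of vertex-disjoint edges covering $V$) is rainbow with respect to the family. *)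

theory Defs
  imports "HOL-Probability.Probability" "HOL-Probability.Product_PMF" "HOL-Library.Landau_Symbols"
begin

text \<open>A simple graph on a fixed vertex set is identified with its set of edges, an edge being a
  two-element set of vertices.  A spanning subgraph has the same vertex set by definition,
  so it is just a subset of the edge set.\<close>

definition vertex_pairs :: "'a set \<Rightarrow> 'a set set" where
  "vertex_pairs V = {e. e \<subseteq> V \<and> card e = 2}"

definition gnp :: "nat \<Rightarrow> real \<Rightarrow> nat set set pmf" where
  "gnp n p = map_pmf (\<lambda>b. {e \<in> vertex_pairs {1..n}. b e})
     (Pi_pmf (vertex_pairs {1..n}) False (\<lambda>_. bernoulli_pmf p))"

definition vertex_degree :: "'a set set \<Rightarrow> 'a \<Rightarrow> nat" where
  "vertex_degree E v = card {e \<in> E. v \<in> e}"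

text \<open>Only meaningful for finite nonempty \<open>V\<close>.\<close>

definition min_degree :: "'a set \<Rightarrow> 'a set set \<Rightarrow> nat" where
  "min_degree V E = Min (vertex_degree E ` V)"

definition perfect_matching :: "'a set \<Rightarrow> 'a set set \<Rightarrow> bool" where
  "perfect_matching V F \<longleftrightarrow> F \<subseteq> vertex_pairs V \<and> pairwise disjnt F \<and> \<Union>F = V"

text \<open>The family \<open>H 1, \<dots>, H m\<close> is a function of which only the values on \<open>{1..m}\<close> matter.\<close>

definition rainbow :: "nat \<Rightarrow> (nat \<Rightarrow> 'a set set) \<Rightarrow> 'a set set \<Rightarrow> bool" where
  "rainbow m H F \<longleftrightarrow>
     (\<exists>\<phi>. inj_on \<phi> F \<and> \<phi> ` F \<subseteq> {1..m} \<and> (\<forall>e\<in>F. e \<in> H (\<phi> e)))"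

definition has_rainbow_perfect_matching ::
    "'a set \<Rightarrow> nat \<Rightarrow> (nat \<Rightarrow> 'a set set) \<Rightarrow> bool" where
  "has_rainbow_perfect_matching V m H \<longleftrightarrow> (\<exists>F. perfect_matching V F \<and> rainbow m H F)"

text \<open>The filter expressing that \<open>n\<close> tends to infinity along the even numbers.\<close>

definition even_at_top :: "nat filter" where
  "even_at_top = inf at_top (principal {n. even n})"

text \<open>Growth conditions are stated with the Landau symbol \<open>\<omega>[even_at_top]\<close>.  Spelled as a limit of
  quotients, the condition needs \<open>p\<close> to be eventually nonzero, as \<open>x / 0 = 0\<close>.\<close>

lemma smallomega_iff_quotient_tendsto_0:
  fixes p g :: "nat \<Rightarrow> real"
  assumes "eventually (\<lambda>n. p n \<noteq> 0) F"
  shows "p \<in> \<omega>[F](g) \<longleftrightarrow> ((\<lambda>n. g n / p n) \<longlongrightarrow> 0) F"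
  using assms by (auto simp: smallomega_iff_smallo intro: smalloI_tendsto smalloD_tendsto)

end

theory Submission
  imports Defs
begin

text \<open>Write \<open>n = 2 * m\<close> and give vertices to colours at random: for a uniformly random permutation
  \<open>\<sigma>\<close> of the vertex set, colour \<open>c \<le> m\<close> has to use an edge at the vertex \<open>\<sigma> c\<close>, and the other
  half \<open>B = \<sigma> ` {m<..2 * m}\<close> of the vertices is to be matched to these. With this commitment a
  rainbow perfect matching is just a perfect matching of the bipartite graph between
  \<open>A = \<sigma> ` {1..m}\<close> and \<open>B\<close> that joins \<open>\<sigma> c\<close> to \<open>b\<close> when \<open>{\<sigma> c, b} \<in> H c\<close>, since each colour then
  appears exactly once by construction.

  The degree of \<open>\<sigma> c\<close> in this graph, and that of \<open>b\<close>, are both counts of positions \<open>x\<close> at which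
  \<open>\<sigma> x\<close> falls into a set prescribed for \<open>x\<close>. The minimum degree hypothesis makes their means at
  least \<open>(1/2 + \<epsilon>) * m * p\<close>. Such a count satisfies a Chernoff bound for the lower tail
  (\<open>permutation_lower_tail\<close>), and as \<open>n * p\<close> is much larger than \<open>ln n\<close>, a union bound over all
  colours and vertices yields one \<open>\<sigma>\<close> for which every degree is at least
  \<open>(1/2 + \<epsilon>/2) * m * p\<close> (\<open>random_order_keeps_degrees\<close>). This part is deterministic as far as
  the random graph is concerned, and so works for all families \<open>H\<close> at once.

  The bipartite graph is a subgraph of \<open>G\<close>, which is all that is known about it besides its
  degrees. If Hall's condition failed, there would be disjoint sets of \<open>k\<close> vertices each, where
  \<open>k\<close> is at most about \<open>m/2\<close>, with at least \<open>k * (1/2 + \<epsilon>/2) * m * p\<close> edges of \<open>G\<close> between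
  them (\<open>dense_subgraph_has_matching\<close>). The expected number of edges is only
  \<open>k * k * p\<close>, about \<open>k * m * p / 2\<close> at most, so by Chernoff and a union bound
  \<open>G(n,p)\<close> has no such pair of sets with high probability (\<open>gnp_locally_sparse\<close>).\<close>

section \<open>Hall's marriage theorem\<close>

text \<open>Halmos and Vaughan's induction: if some proper subset is critical, that is, has exactly as many
  neighbours as elements, match it to its neighbours and the rest to the remaining ones; otherwise
  there is a spare neighbour everywhere, and any single pair can be split off.\<close>

theorem hall_marriage:
  fixes N :: "'a \<Rightarrow> 'b set"
  assumes "finite A" and "\<And>a. a \<in> A \<Longrightarrow> finite (N a)"
    and "\<And>X. X \<subseteq> A \<Longrightarrow> card X \<le> card (\<Union>(N ` X))"
  shows "\<exists>f. inj_on f A \<and> (\<forall>a\<in>A. f a \<in> N a)"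
  using assms
proof (induction A arbitrary: N rule: finite_psubset_induct)
  case (psubset A)
  have fin_Un: "finite (\<Union>(N ` X))" if "X \<subseteq> A" for X
    using that psubset.hyps psubset.prems(1) by (auto intro: finite_subset)
  show ?case
  proof (cases "\<exists>X. X \<subset> A \<and> X \<noteq> {} \<and> card (\<Union>(N ` X)) \<le> card X")
    case True
    then obtain X where X: "X \<subset> A" "X \<noteq> {}" "card (\<Union>(N ` X)) \<le> card X" by blast
    define U where "U = \<Union>(N ` X)"
    have finX: "finite X" and finU: "finite U"
      using X psubset.hyps fin_Un[of X] by (auto simp: U_def intro: finite_subset)
    have "\<exists>f. inj_on f X \<and> (\<forall>a\<in>X. f a \<in> N a)"
      using X psubset.prems by (intro psubset.IH) auto
    then obtain f where f: "inj_on f X" "\<forall>a\<in>X. f a \<in> N a" by blast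
    \<comment> \<open>The neighbours of a critical set can be removed: Hall's condition for \<open>Y \<union> X\<close> leaves
      enough of them for \<open>Y\<close>.\<close>
    have "\<exists>g. inj_on g (A - X) \<and> (\<forall>a\<in>A - X. g a \<in> N a - U)"
    proof (rule psubset.IH)
      show "A - X \<subset> A" using X by blast
      show "finite (N a - U)" if "a \<in> A - X" for a using that psubset.prems by auto
      fix Y assume Y: "Y \<subseteq> A - X"
      have finY: "finite Y" using Y psubset.hyps by (auto intro: finite_subset)
      have "card Y + card X = card (Y \<union> X)"
        using Y finX finY by (intro card_Un_disjoint[symmetric]) auto
      also have "\<dots> \<le> card (\<Union>(N ` (Y \<union> X)))"
        using X Y by (intro psubset.prems) auto
      also have "\<Union>(N ` (Y \<union> X)) = (\<Union>a\<in>Y. N a - U) \<union> U" by (auto simp: U_def)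
      also have "card \<dots> \<le> card (\<Union>a\<in>Y. N a - U) + card U" by (rule card_Un_le)
      finally show "card Y \<le> card (\<Union>a\<in>Y. N a - U)" using X(3) by (simp add: U_def)
    qed
    then obtain g where g: "inj_on g (A - X)" "\<forall>a\<in>A - X. g a \<in> N a - U" by blast
    define h where "h = (\<lambda>a. if a \<in> X then f a else g a)"
    have "inj_on h A"
    proof (rule inj_onI)
      fix a b assume ab: "a \<in> A" "b \<in> A" "h a = h b"
      have *: "f x \<noteq> g y" if "x \<in> X" "y \<in> A - X" for x y
        using that f(2) g(2) by (fastforce simp: U_def)
      show "a = b"
        using ab f(1) g(1) *[of a b] *[of b a] by (auto simp: h_def inj_on_def split: if_splits)
    qed
    moreover have "\<forall>a\<in>A. h a \<in> N a" using f(2) g(2) by (auto simp: h_def)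
    ultimately show ?thesis by blast
  next
    case False
    show ?thesis
    proof (cases "A = {}")
      case nonempty: False
      then obtain a where a: "a \<in> A" by blast
      have "card {a} \<le> card (\<Union>(N ` {a}))" using a by (intro psubset.prems) auto
      then obtain b where b: "b \<in> N a" by fastforce
      have "\<exists>g. inj_on g (A - {a}) \<and> (\<forall>x\<in>A - {a}. g x \<in> N x - {b})"
      proof (rule psubset.IH)
        show "A - {a} \<subset> A" using a by blast
        show "finite (N x - {b})" if "x \<in> A - {a}" for x using that psubset.prems by auto
        fix X assume X: "X \<subseteq> A - {a}"
        show "card X \<le> card (\<Union>x\<in>X. N x - {b})"
        proof (cases "X = {}")
          case False
          then have "card X < card (\<Union>(N ` X))"
            using \<open>\<not> (\<exists>X. _ X)\<close> X a by (metis Diff_iff insertI1 not_le psubsetI subset_Diff_insert subset_iff)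
          moreover have "(\<Union>x\<in>X. N x - {b}) = \<Union>(N ` X) - {b}" by auto
          ultimately show ?thesis
            using fin_Un[of X] X by (auto simp: card_Diff_singleton_if)
        qed auto
      qed
      then obtain g where g: "inj_on g (A - {a})" "\<forall>x\<in>A - {a}. g x \<in> N x - {b}" by blast
      have "inj_on (g(a := b)) A" using g by (fastforce simp: inj_on_def)
      moreover have "\<forall>x\<in>A. (g(a := b)) x \<in> N x" using g b by auto
      ultimately show ?thesis by blast
    qed auto
  qed
qed

section \<open>Lower tail for random permutations\<close>

definition hits :: "'a set \<Rightarrow> ('a \<Rightarrow> 'b set) \<Rightarrow> ('a \<Rightarrow> 'b) \<Rightarrow> nat" where
  "hits U S \<sigma> = card {x \<in> U. \<sigma> x \<in> S x}"

lemma hits_transpose_le: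
  assumes "finite U" "\<tau> permutes U"
  shows "hits U S \<tau> \<le> hits U S (Transposition.transpose a b \<circ> \<tau>) + 2"
proof -
  have "{x \<in> U. \<tau> x \<in> S x} \<subseteq> {x \<in> U. (Transposition.transpose a b \<circ> \<tau>) x \<in> S x} \<union> {inv \<tau> a, inv \<tau> b}"
    (is "?A \<subseteq> ?B \<union> ?C")
  proof
    fix x assume x: "x \<in> ?A"
    show "x \<in> ?B \<union> ?C"
    proof (cases "\<tau> x = a \<or> \<tau> x = b")
      case True
      then show ?thesis using permutes_inverses(2)[OF assms(2), of x] by auto
    next
      case False
      then show ?thesis using x by (auto simp: Transposition.transpose_def)
    qed
  qed
  then have "card ?A \<le> card (?B \<union> ?C)" using assms by (intro card_mono) auto
  also have "\<dots> \<le> card ?B + card ?C" by (rule card_Un_le)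
  also have "card ?C \<le> 2" by (simp add: card_insert_if)
  finally show ?thesis by (simp add: hits_def)
qed

text \<open>Composing with the transposition of \<open>a\<close> and \<open>b\<close> turns the permutations that map \<open>x\<close> to \<open>a\<close>
  into those that map \<open>x\<close> to \<open>b\<close>. By \<open>hits_transpose_le\<close> it costs at most two hits, one of which
  is paid for by the hit at \<open>x\<close>, left out in \<open>hits U S \<tau> - 1\<close>. Hence conditioning on
  \<open>\<sigma> x = a\<close> lowers the generating function of the other hits by at most a factor \<open>q\<close>.\<close>

lemma sum_permutes_fixed_value:
  fixes q :: real
  assumes U: "finite U" "x \<in> U" "a \<in> U" and a: "a \<in> S x" and q: "0 \<le> q" "q \<le> 1"
  shows "q * (\<Sum>\<sigma> | \<sigma> permutes U. q ^ hits U S \<sigma>)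
           \<le> card U * (\<Sum>\<tau> | \<tau> permutes U \<and> \<tau> x = a. q ^ (hits U S \<tau> - 1))"
proof -
  let ?P = "\<lambda>b. {\<sigma>. \<sigma> permutes U \<and> \<sigma> x = b}"
  have finP: "finite {\<sigma>. \<sigma> permutes U}" by (rule finite_permutations[OF U(1)])
  have part: "q * (\<Sum>\<sigma>\<in>?P b. q ^ hits U S \<sigma>) \<le> (\<Sum>\<tau>\<in>?P a. q ^ (hits U S \<tau> - 1))"
    if b: "b \<in> U" for b
  proof -
    have perm: "Transposition.transpose c d \<circ> \<sigma> permutes U"
      if "\<sigma> permutes U" "c \<in> U" "d \<in> U" for \<sigma> c d
      using that by (intro permutes_compose permutes_swap_id)
    have inv: "Transposition.transpose a b \<circ> (Transposition.transpose a b \<circ> \<sigma>) = \<sigma>" for \<sigma> :: "'a \<Rightarrow> 'a"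
      by (auto simp: fun_eq_iff)
    have bij: "bij_betw (\<lambda>\<tau>. Transposition.transpose a b \<circ> \<tau>) (?P a) (?P b)"
      using U(3) b
      by (intro bij_betw_byWitness[where f' = "\<lambda>\<sigma>. Transposition.transpose a b \<circ> \<sigma>"])
        (auto simp: inv intro: perm)
    have "q * (\<Sum>\<sigma>\<in>?P b. q ^ hits U S \<sigma>)
        = (\<Sum>\<tau>\<in>?P a. q ^ Suc (hits U S (Transposition.transpose a b \<circ> \<tau>)))"
      by (simp add: sum_distrib_left sum.reindex_bij_betw[OF bij, symmetric])
    also have "\<dots> \<le> (\<Sum>\<tau>\<in>?P a. q ^ (hits U S \<tau> - 1))"
    proof (rule sum_mono)
      fix \<tau> assume "\<tau> \<in> ?P a"
      then show "q ^ Suc (hits U S (Transposition.transpose a b \<circ> \<tau>)) \<le> q ^ (hits U S \<tau> - 1)"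
        using hits_transpose_le[OF U(1), of \<tau> S a b] q by (intro power_decreasing) auto
    qed
    finally show ?thesis .
  qed
  have "(\<lambda>\<sigma>. \<sigma> x) ` {\<sigma>. \<sigma> permutes U} \<subseteq> U"
    using U(2) by (auto simp: permutes_in_image)
  then have "q * (\<Sum>\<sigma> | \<sigma> permutes U. q ^ hits U S \<sigma>)
      = q * (\<Sum>b\<in>U. \<Sum>\<sigma>\<in>?P b. q ^ hits U S \<sigma>)"
    using sum.group[OF finP U(1), of "\<lambda>\<sigma>. \<sigma> x" "\<lambda>\<sigma>. q ^ hits U S \<sigma>"] by simp
  also have "\<dots> = (\<Sum>b\<in>U. q * (\<Sum>\<sigma>\<in>?P b. q ^ hits U S \<sigma>))" by (rule sum_distrib_left)
  also have "\<dots> \<le> (\<Sum>b\<in>U. \<Sum>\<tau>\<in>?P a. q ^ (hits U S \<tau> - 1))" by (rule sum_mono[OF part])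
  finally show ?thesis by simp
qed

text \<open>The differential inequality \<open>\<mu> * q * \<Phi> q \<le> \<Phi>' q\<close> for the generating function \<open>\<Phi>\<close> of
  the number of hits, with \<open>\<mu>\<close> its mean. The derivative is a sum over the hits
  \<open>\<sigma> x = a\<close> with \<open>a \<in> S x\<close>, each of which is estimated by \<open>sum_permutes_fixed_value\<close>.
  For independent hits the factor \<open>q\<close> would be absent; for \<open>q\<close> near 1 it only costs a term of second order.\<close>

lemma permutation_mgf_derivative:
  fixes q :: real
  assumes U: "finite U" "U \<noteq> {}" and S: "\<And>x. x \<in> U \<Longrightarrow> S x \<subseteq> U" and q: "0 \<le> q" "q \<le> 1"
  shows "(\<Sum>x\<in>U. card (S x)) / card U * q * (\<Sum>\<sigma> | \<sigma> permutes U. q ^ hits U S \<sigma>)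
           \<le> (\<Sum>\<sigma> | \<sigma> permutes U. hits U S \<sigma> * q ^ (hits U S \<sigma> - 1))"
proof -
  define P where "P = {\<sigma>. \<sigma> permutes U}"
  define \<Phi> where "\<Phi> = (\<Sum>\<sigma>\<in>P. q ^ hits U S \<sigma>)"
  have finP: "finite P" unfolding P_def by (rule finite_permutations[OF U(1)])
  have finS: "finite (S x)" if "x \<in> U" for x using S[OF that] U(1) by (rule finite_subset)
  have n: "real (card U) > 0" using U by (simp add: card_gt_0_iff)
  have step: "q * \<Phi> / card U \<le> (\<Sum>\<sigma>\<in>{\<sigma>\<in>P. \<sigma> x = a}. q ^ (hits U S \<sigma> - 1))"
    if "x \<in> U" "a \<in> S x" for x a
    using sum_permutes_fixed_value[of U x a S q] that S U q n
    by (auto simp: P_def \<Phi>_def field_simps)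
  have "(\<Sum>x\<in>U. card (S x)) / card U * q * \<Phi> = (\<Sum>x\<in>U. \<Sum>a\<in>S x. q * \<Phi> / card U)"
    by (simp add: sum_divide_distrib sum_distrib_left sum_distrib_right mult_ac)
  also have "\<dots> \<le> (\<Sum>x\<in>U. \<Sum>a\<in>S x. \<Sum>\<sigma>\<in>{\<sigma>\<in>P. \<sigma> x = a}. q ^ (hits U S \<sigma> - 1))"
    by (intro sum_mono step)
  also have "\<dots> = (\<Sum>x\<in>U. \<Sum>a\<in>S x. \<Sum>\<sigma>\<in>P. if \<sigma> x = a then q ^ (hits U S \<sigma> - 1) else 0)"
    using finP by (intro sum.cong refl sum.inter_filter) auto
  also have "\<dots> = (\<Sum>x\<in>U. \<Sum>\<sigma>\<in>P. \<Sum>a\<in>S x. if \<sigma> x = a then q ^ (hits U S \<sigma> - 1) else 0)"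
    by (intro sum.cong refl sum.swap)
  also have "\<dots> = (\<Sum>x\<in>U. \<Sum>\<sigma>\<in>P. if \<sigma> x \<in> S x then q ^ (hits U S \<sigma> - 1) else 0)"
    using finS by (intro sum.cong refl) (auto simp: sum.delta)
  also have "\<dots> = (\<Sum>\<sigma>\<in>P. \<Sum>x\<in>U. if \<sigma> x \<in> S x then q ^ (hits U S \<sigma> - 1) else 0)"
    by (rule sum.swap)
  also have "\<dots> = (\<Sum>\<sigma>\<in>P. \<Sum>x\<in>{x\<in>U. \<sigma> x \<in> S x}. q ^ (hits U S \<sigma> - 1))"
    using U(1) by (intro sum.cong refl sum.inter_filter[symmetric]) auto
  also have "\<dots> = (\<Sum>\<sigma>\<in>P. hits U S \<sigma> * q ^ (hits U S \<sigma> - 1))"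
    by (simp add: hits_def)
  finally show ?thesis by (simp add: P_def \<Phi>_def)
qed

text \<open>Integrating the differential inequality from \<open>q\<close> to 1: it says that
  \<open>\<Phi> q * exp (- \<mu> * q\<^sup>2 / 2)\<close> is nondecreasing, and \<open>\<Phi> 1\<close> counts all permutations.\<close>

lemma permutation_mgf_le:
  fixes q \<mu> :: real
  assumes U: "finite U" "U \<noteq> {}" and S: "\<And>x. x \<in> U \<Longrightarrow> S x \<subseteq> U"
    and \<mu>: "\<mu> \<le> (\<Sum>x\<in>U. card (S x)) / card U" and q: "0 \<le> q" "q \<le> 1"
  shows "(\<Sum>\<sigma> | \<sigma> permutes U. q ^ hits U S \<sigma>) \<le> fact (card U) * exp (- \<mu> * (1 - q\<^sup>2) / 2)"
proof -
  define \<Phi> where "\<Phi> = (\<lambda>q::real. \<Sum>\<sigma> | \<sigma> permutes U. q ^ hits U S \<sigma>)"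
  define g where "g = (\<lambda>q. \<Phi> q * exp (- \<mu> * q\<^sup>2 / 2))"
  have "g q \<le> g 1"
  proof (rule DERIV_nonneg_imp_nondecreasing[OF q(2)])
    fix r :: real assume r: "q \<le> r" "r \<le> 1"
    define D where "D = (\<Sum>\<sigma> | \<sigma> permutes U. hits U S \<sigma> * r ^ (hits U S \<sigma> - 1))"
    have "(\<Phi> has_real_derivative D) (at r)"
      unfolding \<Phi>_def D_def by (auto intro!: derivative_eq_intros)
    then have "(g has_real_derivative (D - \<mu> * r * \<Phi> r) * exp (- \<mu> * r\<^sup>2 / 2)) (at r)"
      unfolding g_def by (auto intro!: derivative_eq_intros simp: algebra_simps)
    moreover have "\<mu> * r * \<Phi> r \<le> D"
    proof -
      have "\<mu> * (r * \<Phi> r) \<le> (\<Sum>x\<in>U. card (S x)) / card U * (r * \<Phi> r)"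
        using r q \<mu> by (intro mult_right_mono mult_nonneg_nonneg) (auto simp: \<Phi>_def intro: sum_nonneg)
      also have "\<dots> \<le> D"
        using permutation_mgf_derivative[where q = r, OF U S] r q by (simp add: \<Phi>_def D_def mult_ac)
      finally show ?thesis by (simp add: mult_ac)
    qed
    ultimately show "\<exists>y. (g has_real_derivative y) (at r) \<and> 0 \<le> y"
      by (intro exI[of _ "(D - \<mu> * r * \<Phi> r) * exp (- \<mu> * r\<^sup>2 / 2)"]) auto
  qed
  moreover have "\<Phi> 1 = fact (card U)"
    using U card_permutations[of U "card U"] by (simp add: \<Phi>_def)
  ultimately have "\<Phi> q * exp (- \<mu> * q\<^sup>2 / 2) \<le> fact (card U) * exp (- \<mu> / 2)"
    by (simp add: g_def)
  then have "\<Phi> q * exp (- \<mu> * q\<^sup>2 / 2) * exp (\<mu> * q\<^sup>2 / 2)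
      \<le> fact (card U) * exp (- \<mu> / 2) * exp (\<mu> * q\<^sup>2 / 2)"
    by (intro mult_right_mono) auto
  then show ?thesis
    by (simp add: \<Phi>_def mult.assoc flip: exp_add) (simp add: algebra_simps diff_divide_distrib)
qed

text \<open>Exponential Markov inequality for \<open>permutation_mgf_le\<close>. A bound of Chernoff type is essential:
  since \<open>\<mu>\<close> may be far smaller than the square root of \<open>card U\<close>, a bounded difference inequality
  says nothing.\<close>

theorem permutation_lower_tail:
  fixes \<delta> \<mu> :: real
  assumes U: "finite U" "U \<noteq> {}" and S: "\<And>x. x \<in> U \<Longrightarrow> S x \<subseteq> U"
    and \<mu>: "0 \<le> \<mu>" "\<mu> \<le> (\<Sum>x\<in>U. card (S x)) / card U" and \<delta>: "0 \<le> \<delta>" "\<delta> \<le> 1"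
  shows "card {\<sigma>. \<sigma> permutes U \<and> hits U S \<sigma> \<le> (1 - \<delta>) * \<mu>}
           \<le> fact (card U) * exp (- \<mu> * \<delta>\<^sup>2 / 10)"
proof -
  \<comment> \<open>With \<open>q = 1 - \<theta>\<close> the exponent is at most \<open>\<mu> * (- \<delta> * \<theta> + 5 / 2 * \<theta>\<^sup>2)\<close>, which is smallest
    at \<open>\<theta> = \<delta> / 5\<close>.\<close>
  define \<theta> where "\<theta> = \<delta> / 5"
  define q where "q = 1 - \<theta>"
  define t where "t = (1 - \<delta>) * \<mu>"
  define B where "B = {\<sigma>. \<sigma> permutes U \<and> hits U S \<sigma> \<le> t}"
  have \<theta>: "0 \<le> \<theta>" "\<theta> \<le> 1/5" and q: "0 < q" "q \<le> 1" using \<delta> by (auto simp: \<theta>_def q_def)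
  have t: "0 \<le> t" using \<delta> \<mu> by (simp add: t_def)
  have ln_q: "- \<theta> - 2 * \<theta>\<^sup>2 \<le> ln q"
    using ln_one_minus_pos_lower_bound[of \<theta>] \<theta> by (simp add: q_def)
  have finP: "finite {\<sigma>. \<sigma> permutes U}" by (rule finite_permutations[OF U(1)])
  have "card B * exp (t * (- \<theta> - 2 * \<theta>\<^sup>2)) \<le> card B * q powr t"
    using q t ln_q by (intro mult_left_mono) (auto simp: powr_def mult_left_mono)
  also have "\<dots> = (\<Sum>\<sigma>\<in>B. q powr t)" by simp
  also have "\<dots> \<le> (\<Sum>\<sigma>\<in>B. q ^ hits U S \<sigma>)"
  proof (rule sum_mono)
    fix \<sigma> assume "\<sigma> \<in> B"
    then have "q powr t \<le> q powr hits U S \<sigma>" using q by (intro powr_mono') (auto simp: B_def)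
    then show "q powr t \<le> q ^ hits U S \<sigma>" using q by (simp add: powr_realpow)
  qed
  also have "\<dots> \<le> (\<Sum>\<sigma> | \<sigma> permutes U. q ^ hits U S \<sigma>)"
    using finP q by (intro sum_mono2) (auto simp: B_def)
  also have "\<dots> \<le> fact (card U) * exp (- \<mu> * (1 - q\<^sup>2) / 2)"
    using q by (intro permutation_mgf_le[OF U S \<mu>(2)]) auto
  finally have "card B * exp (t * (- \<theta> - 2 * \<theta>\<^sup>2)) * exp (t * (\<theta> + 2 * \<theta>\<^sup>2))
      \<le> fact (card U) * exp (- \<mu> * (1 - q\<^sup>2) / 2) * exp (t * (\<theta> + 2 * \<theta>\<^sup>2))"
    by (intro mult_right_mono) auto
  moreover have "exp (t * (- \<theta> - 2 * \<theta>\<^sup>2)) * exp (t * (\<theta> + 2 * \<theta>\<^sup>2)) = 1"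
    by (simp flip: exp_add) (simp add: algebra_simps)
  ultimately have "card B
      \<le> fact (card U) * (exp (- \<mu> * (1 - q\<^sup>2) / 2) * exp (t * (\<theta> + 2 * \<theta>\<^sup>2)))"
    by (simp add: mult.assoc)
  also have "exp (- \<mu> * (1 - q\<^sup>2) / 2) * exp (t * (\<theta> + 2 * \<theta>\<^sup>2))
      = exp (- \<mu> * \<delta>\<^sup>2 / 10 - 2 * \<mu> * \<delta> * \<theta>\<^sup>2)"
    by (simp flip: exp_add add: t_def q_def \<theta>_def power2_eq_square power3_eq_cube field_simps)
  also have "\<dots> \<le> exp (- \<mu> * \<delta>\<^sup>2 / 10)" using \<mu> \<delta> by simp
  finally show ?thesis by (simp add: B_def t_def)
qed

lemma permutation_many_lower_tails:
  fixes \<delta> \<mu> :: real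
  assumes U: "finite U" "U \<noteq> {}" and fin: "finite \<S>"
    and S: "\<And>S x. S \<in> \<S> \<Longrightarrow> x \<in> U \<Longrightarrow> S x \<subseteq> U"
    and mean: "0 \<le> \<mu>" "\<And>S. S \<in> \<S> \<Longrightarrow> \<mu> \<le> (\<Sum>x\<in>U. card (S x)) / card U"
    and \<delta>: "0 \<le> \<delta>" "\<delta> \<le> 1"
    and few: "card \<S> * exp (- \<mu> * \<delta>\<^sup>2 / 10) < 1"
  shows "\<exists>\<sigma>. \<sigma> permutes U \<and> (\<forall>S\<in>\<S>. hits U S \<sigma> > (1 - \<delta>) * \<mu>)"
proof (rule ccontr)
  define bad where "bad = (\<lambda>S. {\<sigma>. \<sigma> permutes U \<and> hits U S \<sigma> \<le> (1 - \<delta>) * \<mu>})"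
  assume "\<not> ?thesis"
  then have "{\<sigma>. \<sigma> permutes U} \<subseteq> \<Union>(bad ` \<S>)" by (fastforce simp: bad_def not_less)
  moreover have "finite (bad S)" for S
    using finite_permutations[OF U(1)] by (rule finite_subset[rotated]) (auto simp: bad_def)
  ultimately have "card {\<sigma>. \<sigma> permutes U} \<le> card (\<Union>(bad ` \<S>))"
    using fin by (intro card_mono) auto
  also have "\<dots> \<le> (\<Sum>S\<in>\<S>. card (bad S))" by (rule card_UN_le[OF fin])
  finally have "real (fact (card U)) \<le> real (\<Sum>S\<in>\<S>. card (bad S))"
    unfolding card_permutations[OF refl U(1)] by (rule of_nat_mono)
  then have "fact (card U) \<le> (\<Sum>S\<in>\<S>. real (card (bad S)))" by simp
  also have "\<dots> \<le> (\<Sum>S\<in>\<S>. fact (card U) * exp (- \<mu> * \<delta>\<^sup>2 / 10))"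
    unfolding bad_def using U S mean \<delta> by (intro sum_mono permutation_lower_tail) auto
  also have "\<dots> = fact (card U) * (card \<S> * exp (- \<mu> * \<delta>\<^sup>2 / 10))" by simp
  also have "\<dots> < fact (card U) * 1" using few by (intro mult_strict_left_mono) auto
  finally show False by simp
qed

section \<open>Matchings in subgraphs of locally sparse graphs\<close>

definition edges_between :: "'a set set \<Rightarrow> 'a set \<Rightarrow> 'a set \<Rightarrow> ('a \<times> 'a) set" where
  "edges_between G X Y = {(x, y). x \<in> X \<and> y \<in> Y \<and> {x, y} \<in> G}"

text \<open>The bound \<open>r\<close> is on the total size of the two sets rather than on each of them, so that odd
  values make sense: the sets needed below may exceed half of a vertex class by a half.\<close>

definition locally_sparse :: "'a set \<Rightarrow> nat \<Rightarrow> real \<Rightarrow> 'a set set \<Rightarrow> bool" where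
  "locally_sparse V r d G \<longleftrightarrow>
     (\<forall>X Y. X \<subseteq> V \<longrightarrow> Y \<subseteq> V \<longrightarrow> X \<inter> Y = {} \<longrightarrow> X \<noteq> {} \<longrightarrow> card X = card Y \<longrightarrow> 2 * card X \<le> r
        \<longrightarrow> real (card (edges_between G X Y)) < d * real (card X))"

text \<open>If \<open>X\<close> had fewer neighbours than elements, the neighbours could be padded to a set \<open>Y\<close> of
  the size of \<open>X\<close>, and the \<open>d * card X\<close> edges from \<open>X\<close> would all end in \<open>Y\<close>.\<close>

lemma small_set_expands:
  fixes d :: real
  assumes sparse: "locally_sparse V r d G" and V: "finite V" "A \<subseteq> V" "B \<subseteq> V" "A \<inter> B = {}"
    and E: "\<And>a b. a \<in> A \<Longrightarrow> (a, b) \<in> E \<Longrightarrow> b \<in> B \<and> {a, b} \<in> G"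
    and deg: "\<And>a. a \<in> A \<Longrightarrow> d \<le> card (E `` {a})"
    and X: "X \<subseteq> A" "2 * card X \<le> r" "card X \<le> card B"
  shows "card X \<le> card (E `` X)"
proof (rule ccontr)
  assume less: "\<not> card X \<le> card (E `` X)"
  have fin: "finite A" "finite B" using V by (auto intro: finite_subset)
  then have finX: "finite X" using X(1) by (auto intro: finite_subset)
  have "E `` X \<subseteq> B" using E X by blast
  then obtain Y where Y: "E `` X \<subseteq> Y" "Y \<subseteq> B" "card Y = card X"
    using exists_subset_between[of "E `` X" "card X" B] less X(3) fin by auto
  have finY: "finite Y" using Y fin by (auto intro: finite_subset)
  have "real (card X) * d = (\<Sum>a\<in>X. d)" by simp
  also have "\<dots> \<le> (\<Sum>a\<in>X. real (card (E `` {a})))"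
    using deg X by (intro sum_mono) auto
  also have "\<dots> = card (SIGMA a:X. E `` {a})"
    using finX Y finY by (subst card_SigmaI) (auto intro: finite_subset[of _ Y])
  also have "\<dots> \<le> card (edges_between G X Y)"
    using finX finY E X Y
    by (intro of_nat_mono card_mono) (auto simp: edges_between_def intro: finite_subset[of _ "X \<times> Y"])
  also have "\<dots> < d * card X"
    using less X Y V
    by (intro sparse[unfolded locally_sparse_def, rule_format]) auto
  finally show False by simp
qed

text \<open>A violation \<open>X \<subseteq> A\<close> of Hall's condition with \<open>card X\<close> beyond half of \<open>A\<close> gives one on the
  other side: the vertices of \<open>B\<close> not adjacent to \<open>X\<close> have all their neighbours in \<open>A - X\<close>.
  So it suffices that sets of at most half the size, rounded up, expand on both sides.\<close>

theorem dense_subgraph_has_matching: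
  fixes d :: real
  assumes sparse: "locally_sparse V (Suc (card A)) d G"
    and V: "finite V" "A \<subseteq> V" "B \<subseteq> V" "A \<inter> B = {}" "card A = card B"
    and E: "\<And>a b. (a, b) \<in> E \<Longrightarrow> a \<in> A \<and> b \<in> B \<and> {a, b} \<in> G"
    and degA: "\<And>a. a \<in> A \<Longrightarrow> d \<le> card (E `` {a})"
    and degB: "\<And>b. b \<in> B \<Longrightarrow> d \<le> card (E\<inverse> `` {b})"
  shows "\<exists>f. bij_betw f A B \<and> (\<forall>a\<in>A. (a, f a) \<in> E)"
proof -
  have fin: "finite A" "finite B" using V by (auto intro: finite_subset)
  have "\<exists>f. inj_on f A \<and> (\<forall>a\<in>A. f a \<in> E `` {a})"
  proof (rule hall_marriage[OF fin(1)])
    show "finite (E `` {a})" if "a \<in> A" for a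
      using E fin by (auto intro: finite_subset[of _ B])
    fix X assume X: "X \<subseteq> A"
    have "card X \<le> card (E `` X)"
    proof (cases "2 * card X \<le> Suc (card A)")
      case True
      then show ?thesis
        using X V E degA card_mono[OF fin(1) X]
        by (intro small_set_expands[OF sparse, of A B]) auto
    next
      case large: False
      show ?thesis
      proof (rule ccontr)
        assume less: "\<not> card X \<le> card (E `` X)"
        have "E `` X \<subseteq> B" using E by blast
        then have "card (B - E `` X) = card B - card (E `` X)"
          using fin by (intro card_Diff_subset) (auto intro: finite_subset)
        then have "Suc (card A - card X) \<le> card (B - E `` X)"
          using less V(5) card_mono[OF fin(1) X] by simp
        \<comment> \<open>One element more than \<open>A - X\<close> has already violates the expansion, and keeps \<open>Y\<close> small.\<close>
        then obtain Y where Y: "Y \<subseteq> B - E `` X" "card Y = Suc (card A - card X)"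
          by (meson obtain_subset_with_card_n)
        have E': "a \<in> A \<and> {b, a} \<in> G" if "(a, b) \<in> E" for a b
          using E[OF that] by (simp add: insert_commute)
        have "card Y \<le> card (E\<inverse> `` Y)"
          using Y V E' degB large card_mono[OF fin(1) X]
          by (intro small_set_expands[OF sparse, of B A]) auto
        also have "\<dots> \<le> card (A - X)"
          using Y E fin by (intro card_mono) auto
        also have "\<dots> = card A - card X"
          using X fin by (intro card_Diff_subset) (auto intro: finite_subset)
        finally show False using Y by simp
      qed
    qed
    also have "E `` X = (\<Union>a\<in>X. E `` {a})" by auto
    finally show "card X \<le> card (\<Union>a\<in>X. E `` {a})" .
  qed
  then obtain f where f: "inj_on f A" "\<forall>a\<in>A. (a, f a) \<in> E" by auto
  have "f ` A = B"
    using f E V(5) fin by (intro card_subset_eq) (auto simp: card_image)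
  then show ?thesis using f by (auto simp: bij_betw_def)
qed

section \<open>Random assignment of vertices to colours\<close>

text \<open>Each count is a number of hits of the random order \<open>\<sigma>\<close>: the first asks only the positions
  beyond \<open>m\<close>, the second only those up to \<open>m\<close>. As half of the positions are asked, both means are
  at least \<open>D / 2\<close>. These are the degrees at the two sides of the auxiliary bipartite graph; \<open>v\<close>
  ranges over all vertices because \<open>\<sigma>\<close> decides later which of them matter.\<close>

lemma random_order_keeps_degrees:
  fixes D \<delta> :: real and m :: nat and N :: "nat \<Rightarrow> nat \<Rightarrow> nat set"
  defines "U \<equiv> {1..2 * m}"
  assumes m: "0 < m" and D: "0 \<le> D" and \<delta>: "0 \<le> \<delta>" "\<delta> \<le> 1"
    and N: "\<And>c v. c \<in> {1..m} \<Longrightarrow> v \<in> U \<Longrightarrow> N c v \<subseteq> U"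
    and deg: "\<And>c v. c \<in> {1..m} \<Longrightarrow> v \<in> U \<Longrightarrow> D \<le> card (N c v)"
    and few: "real ((2 * m)\<^sup>2 + 2 * m) * exp (- D * \<delta>\<^sup>2 / 20) < 1"
  obtains \<sigma> where "\<sigma> permutes U"
    "\<And>c v. c \<in> {1..m} \<Longrightarrow> v \<in> U \<Longrightarrow> (1 - \<delta>) * (D / 2) \<le> card {j \<in> {m<..2 * m}. \<sigma> j \<in> N c v}"
    "\<And>v. v \<in> U \<Longrightarrow> (1 - \<delta>) * (D / 2) \<le> card {c \<in> {1..m}. \<sigma> c \<in> N c v}"
proof -
  define late where "late = (\<lambda>(c, v) j. if m < j then N c v else {})"
  define early where "early = (\<lambda>v j. if j \<le> m then N j v else {})"
  define \<S> where "\<S> = late ` ({1..m} \<times> U) \<union> early ` U"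
  have split: "U = {1..m} \<union> {m<..2 * m}" using m by (auto simp: U_def)
  have "card \<S> \<le> card ({1..m} \<times> U) + card U"
    unfolding \<S>_def U_def by (intro order.trans[OF card_Un_le] add_mono card_image_le) auto
  also have "\<dots> \<le> (2 * m)\<^sup>2 + 2 * m" by (simp add: U_def power2_eq_square)
  finally have "real (card \<S>) * exp (- D * \<delta>\<^sup>2 / 20)
      \<le> real ((2 * m)\<^sup>2 + 2 * m) * exp (- D * \<delta>\<^sup>2 / 20)"
    by (intro mult_right_mono of_nat_mono) auto
  from le_less_trans[OF this few] have few': "card \<S> * exp (- (D / 2) * \<delta>\<^sup>2 / 10) < 1"
    by simp
  have mean: "D / 2 \<le> (\<Sum>x\<in>U. card (S x)) / card U" if "S \<in> \<S>" for S
  proof -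
    have card_U: "real (card U) = 2 * m" by (simp add: U_def)
    consider c v where "c \<in> {1..m}" "v \<in> U" "S = late (c, v)" | v where "v \<in> U" "S = early v"
      using \<open>S \<in> \<S>\<close> unfolding \<S>_def by blast
    then have "real m * D \<le> (\<Sum>x\<in>U. card (S x))"
    proof cases
      case 1
      have "real m * D = (\<Sum>x\<in>{m<..2 * m}. D)" by simp
      also have "\<dots> \<le> (\<Sum>x\<in>{m<..2 * m}. real (card (S x)))"
        using 1 deg by (intro sum_mono) (auto simp: late_def)
      also have "\<dots> \<le> (\<Sum>x\<in>U. card (S x))"
        unfolding of_nat_sum using split by (intro sum_mono2) (auto simp: U_def)
      finally show ?thesis .
    next
      case 2
      have "real m * D = (\<Sum>x\<in>{1..m}. D)" by simp
      also have "\<dots> \<le> (\<Sum>x\<in>{1..m}. real (card (S x)))"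
        using 2 deg by (intro sum_mono) (auto simp: early_def)
      also have "\<dots> \<le> (\<Sum>x\<in>U. card (S x))"
        unfolding of_nat_sum using split by (intro sum_mono2) (auto simp: U_def)
      finally show ?thesis .
    qed
    then show ?thesis using m unfolding card_U by (simp add: field_simps)
  qed
  have "finite U" "U \<noteq> {}" "finite \<S>" using m by (auto simp: U_def \<S>_def)
  moreover have "S x \<subseteq> U" if "S \<in> \<S>" "x \<in> U" for S x
  proof -
    have "w \<in> U" if "w \<in> N c v" "c \<in> {1..m}" "v \<in> U" for w c v using that N by blast
    moreover have "x \<in> {1..m}" if "x \<le> m" using that \<open>x \<in> U\<close> by (simp add: U_def)
    ultimately show ?thesis
      using \<open>S \<in> \<S>\<close> unfolding \<S>_def late_def early_def by (fastforce split: if_splits)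
  qed
  ultimately have "\<exists>\<sigma>. \<sigma> permutes U \<and> (\<forall>S\<in>\<S>. hits U S \<sigma> > (1 - \<delta>) * (D / 2))"
    using D \<delta> few' mean by (intro permutation_many_lower_tails) auto
  then obtain \<sigma> where \<sigma>: "\<sigma> permutes U" "\<And>S. S \<in> \<S> \<Longrightarrow> hits U S \<sigma> > (1 - \<delta>) * (D / 2)"
    by blast
  have "hits U (late (c, v)) \<sigma> = card {j \<in> {m<..2 * m}. \<sigma> j \<in> N c v}" for c v
    unfolding hits_def by (rule arg_cong[of _ _ card]) (auto simp: late_def U_def split: if_splits)
  moreover have "hits U (early v) \<sigma> = card {c \<in> {1..m}. \<sigma> c \<in> N c v}" for v
    unfolding hits_def by (rule arg_cong[of _ _ card]) (auto simp: early_def U_def split: if_splits)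
  ultimately show ?thesis
    using \<sigma>(2)[of "late (_, _)"] \<sigma>(2)[of "early _"]
    by (intro that[OF \<sigma>(1)]) (auto simp: \<S>_def less_imp_le)
qed

section \<open>Edges between small sets in \<open>G(n,p)\<close>\<close>

lemma finite_vertex_pairs: "finite V \<Longrightarrow> finite (vertex_pairs V)"
  unfolding vertex_pairs_def by (rule finite_subset[of _ "Pow V"]) auto

lemma set_pmf_gnp: "G \<in> set_pmf (gnp n p) \<Longrightarrow> G \<subseteq> vertex_pairs {1..n}"
  by (auto simp: gnp_def)

lemma finite_set_pmf_gnp: "finite (set_pmf (gnp n p))"
  by (rule finite_subset[of _ "Pow (vertex_pairs {1..n})"])
    (use set_pmf_gnp in \<open>auto simp: finite_vertex_pairs\<close>)

lemma gnp_edge_count_mgf: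
  fixes t p :: real and n :: nat and D :: "nat set set"
  assumes D: "D \<subseteq> vertex_pairs {1..n}" and p: "0 \<le> p" "p \<le> 1"
  shows "measure_pmf.expectation (gnp n p) (\<lambda>G. exp (t * card (G \<inter> D)))
           = (1 + p * (exp t - 1)) ^ card D"
proof -
  let ?V = "vertex_pairs {1..n}"
  define w where "w = (\<lambda>e b. if e \<in> D \<and> b then exp t else 1)"
  have fin: "finite ?V" by (simp add: finite_vertex_pairs)
  have w: "exp (t * card ({e \<in> ?V. b e} \<inter> D)) = (\<Prod>e\<in>?V. w e (b e))" for b
  proof -
    have "(\<Prod>e\<in>?V. w e (b e)) = (\<Prod>e\<in>{e \<in> ?V. e \<in> D \<and> b e}. exp t)"
      unfolding w_def using fin by (intro prod.inter_filter[symmetric])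
    also have "{e \<in> ?V. e \<in> D \<and> b e} = {e \<in> ?V. b e} \<inter> D" by auto
    finally show ?thesis by (simp add: exp_of_nat2_mult mult.commute)
  qed
  have "measure_pmf.expectation (gnp n p) (\<lambda>G. exp (t * card (G \<inter> D)))
      = measure_pmf.expectation (Pi_pmf ?V False (\<lambda>_. bernoulli_pmf p)) (\<lambda>b. \<Prod>e\<in>?V. w e (b e))"
    unfolding gnp_def integral_map_pmf w ..
  also have "\<dots> = (\<Prod>e\<in>?V. measure_pmf.expectation (bernoulli_pmf p) (w e))"
    using fin by (intro expectation_prod_Pi_pmf) (auto simp: w_def integrable_measure_pmf_finite)
  also have "\<dots> = (\<Prod>e\<in>?V. if e \<in> D then 1 + p * (exp t - 1) else 1)"
    using p by (intro prod.cong refl) (auto simp: w_def algebra_simps)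
  also have "\<dots> = (\<Prod>e\<in>{e \<in> ?V. e \<in> D}. 1 + p * (exp t - 1))"
    using fin by (intro prod.inter_filter[symmetric])
  also have "{e \<in> ?V. e \<in> D} = D" using D by auto
  finally show ?thesis by simp
qed

text \<open>Chernoff's bound, by the exponential Markov inequality with exponent \<open>\<eta> / 2\<close>. The threshold \<open>a\<close> is
  only required to exceed the mean by a factor of at least \<open>1 + \<eta>\<close>; the estimate in terms of
  \<open>a\<close> remains useful when the mean is much smaller, which is what makes the union bound over
  small vertex sets work.\<close>

lemma gnp_edge_count_upper_tail:
  fixes a \<eta> p :: real and n :: nat and D :: "nat set set"
  assumes D: "D \<subseteq> vertex_pairs {1..n}" and p: "0 \<le> p" "p \<le> 1"
    and \<eta>: "0 \<le> \<eta>" "\<eta> \<le> 1" and a: "(1 + \<eta>) * (card D * p) \<le> a"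
  shows "measure_pmf.prob (gnp n p) {G. a \<le> card (G \<inter> D)} \<le> exp (- a * \<eta>\<^sup>2 / 8)"
proof -
  define t where "t = \<eta> / 2"
  have t: "0 \<le> t" "t \<le> 1" using \<eta> by (auto simp: t_def)
  have "measure_pmf.prob (gnp n p) {G. a \<le> card (G \<inter> D)}
      \<le> measure_pmf.prob (gnp n p) {G \<in> space (gnp n p). exp (t * a) \<le> exp (t * card (G \<inter> D))}"
    using t by (intro measure_pmf.finite_measure_mono) (auto intro: mult_left_mono)
  also have "\<dots> \<le> measure_pmf.expectation (gnp n p) (\<lambda>G. exp (t * card (G \<inter> D))) / exp (t * a)"
    by (intro integral_Markov_inequality_measure[where A = UNIV])
      (auto intro: integrable_measure_pmf_finite finite_set_pmf_gnp)
  also have "\<dots> = (1 + p * (exp t - 1)) ^ card D / exp (t * a)"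
    by (simp add: gnp_edge_count_mgf[OF D p])
  also have "\<dots> \<le> exp (p * (t + t\<^sup>2)) ^ card D / exp (t * a)"
  proof (intro divide_right_mono power_mono)
    have "1 + p * (exp t - 1) \<le> 1 + p * (t + t\<^sup>2)"
      using exp_bound[OF t] p by (intro add_left_mono mult_left_mono) auto
    also have "\<dots> \<le> exp (p * (t + t\<^sup>2))" by (rule exp_ge_add_one_self)
    finally show "1 + p * (exp t - 1) \<le> exp (p * (t + t\<^sup>2))" .
    show "0 \<le> 1 + p * (exp t - 1)" using p t by (intro add_nonneg_nonneg mult_nonneg_nonneg) auto
  qed auto
  also have "\<dots> = exp (card D * p * (t + t\<^sup>2) - t * a)"
    by (simp add: exp_diff mult.assoc flip: exp_of_nat_mult)
  also have "\<dots> \<le> exp (- a * \<eta>\<^sup>2 / 8)"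
  proof -
    define x where "x = card D * p"
    have x: "0 \<le> x" "(1 + \<eta>) * x \<le> a" using p a by (auto simp: x_def)
    have "(1 + \<eta>) * (x * (t + t\<^sup>2) - t * a) = ((1 + \<eta>) * x) * (t + t\<^sup>2) - (1 + \<eta>) * t * a"
      by (simp add: algebra_simps)
    also have "\<dots> \<le> a * (t + t\<^sup>2) - (1 + \<eta>) * t * a"
      using x t by (intro diff_right_mono mult_right_mono) auto
    also have "\<dots> = - (a * \<eta>\<^sup>2 / 4)" by (simp add: t_def power2_eq_square field_simps)
    also have "\<dots> \<le> (1 + \<eta>) * (- a * \<eta>\<^sup>2 / 8)"
    proof -
      have "0 \<le> a" using x \<eta> by (auto intro: order.trans[rotated])
      then have "(1 + \<eta>) * (a * \<eta>\<^sup>2 / 8) \<le> 2 * (a * \<eta>\<^sup>2 / 8)"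
        using \<eta> by (intro mult_right_mono) auto
      then show ?thesis by simp
    qed
    finally have "x * (t + t\<^sup>2) - t * a \<le> - a * \<eta>\<^sup>2 / 8"
      by (rule mult_left_le_imp_le) (use \<eta> in auto)
    then show ?thesis by (simp add: x_def)
  qed
  finally show ?thesis .
qed

lemma edges_between_eq_Int:
  assumes "X \<inter> Y = {}" "X \<subseteq> V" "Y \<subseteq> V"
  obtains D where "D \<subseteq> vertex_pairs V" "card D = card X * card Y"
    "\<And>G. card (edges_between G X Y) = card (G \<inter> D)"
proof -
  let ?h = "\<lambda>(x, y). {x, y}"
  have inj: "inj_on ?h (X \<times> Y)"
    using assms(1) by (auto simp: inj_on_def doubleton_eq_iff)
  show ?thesis
  proof
    show "?h ` (X \<times> Y) \<subseteq> vertex_pairs V"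
      using assms by (auto simp: vertex_pairs_def card_insert_if)
    show "card (?h ` (X \<times> Y)) = card X * card Y"
      by (simp add: card_image[OF inj] card_cartesian_product)
    fix G
    have "inj_on ?h (edges_between G X Y)"
      by (rule inj_on_subset[OF inj]) (auto simp: edges_between_def)
    moreover have "?h ` edges_between G X Y = G \<inter> ?h ` (X \<times> Y)"
      by (auto simp: edges_between_def)
    ultimately show "card (edges_between G X Y) = card (G \<inter> ?h ` (X \<times> Y))"
      by (metis card_image)
  qed
qed

text \<open>For sets of size \<open>k\<close> the hypothesis on \<open>ln n\<close> makes each failure at most \<open>n ^ (- 4 * k)\<close>
  likely, while there are at most \<open>n ^ (2 * k)\<close> pairs of sets. Summing \<open>n ^ (- 2 * k)\<close> over
  \<open>1 \<le> k \<le> n\<close> gives at most \<open>1 / n\<close>.\<close>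

theorem gnp_locally_sparse:
  fixes d \<eta> p :: real and n r :: nat
  assumes n: "0 < n" and p: "0 \<le> p" "p \<le> 1" and \<eta>: "0 \<le> \<eta>" "\<eta> \<le> 1"
    and d: "(1 + \<eta>) * (r * p) \<le> 2 * d" and ln: "4 * ln n \<le> d * \<eta>\<^sup>2 / 8"
  shows "1 - 1 / n \<le> measure_pmf.prob (gnp n p) {G. locally_sparse {1..n} r d G}"
proof -
  let ?M = "measure_pmf (gnp n p)"
  define pairs where "pairs = (\<lambda>k. {(X, Y :: nat set). X \<subseteq> {1..n} \<and> Y \<subseteq> {1..n} \<and> X \<inter> Y = {}
      \<and> card X = k \<and> card Y = k \<and> 2 * k \<le> r})"
  define bad where "bad = (\<lambda>(X, Y :: nat set). {G. d * card X \<le> card (edges_between G X Y)})"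
  have fin: "finite (pairs k)" for k
    by (rule finite_subset[of _ "Pow {1..n} \<times> Pow {1..n}"]) (auto simp: pairs_def)
  have d0: "0 \<le> d" using d \<eta> p by (smt (verit) mult_nonneg_nonneg of_nat_0_le_iff)
  have prob_bad: "measure ?M (bad XY) \<le> 1 / real n ^ (4 * k)" if XY: "XY \<in> pairs k" for XY k
  proof -
    obtain X Y where [simp]: "XY = (X, Y)" by (cases XY)
    have XY: "X \<subseteq> {1..n}" "Y \<subseteq> {1..n}" "X \<inter> Y = {}" "card X = k" "card Y = k" "2 * k \<le> r"
      using that by (auto simp: pairs_def)
    obtain D where D: "D \<subseteq> vertex_pairs {1..n}" "card D = k * k"
      "\<And>G. card (edges_between G X Y) = card (G \<inter> D)"
      using edges_between_eq_Int[OF XY(3,1,2)] XY by metis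
    have "(1 + \<eta>) * (card D * p) * 2 = (1 + \<eta>) * p * k * (2 * k)" by (simp add: D)
    also have "\<dots> \<le> (1 + \<eta>) * p * k * r"
      using XY(6) \<eta> p by (intro mult_left_mono) (auto simp flip: of_nat_mult)
    also have "\<dots> = (1 + \<eta>) * (r * p) * k" by simp
    also have "\<dots> \<le> 2 * d * k" using d by (intro mult_right_mono) auto
    finally have "(1 + \<eta>) * (card D * p) \<le> d * k" by simp
    then have "measure ?M (bad XY) \<le> exp (- (d * k) * \<eta>\<^sup>2 / 8)"
      using gnp_edge_count_upper_tail[OF D(1) p \<eta>, of "d * k"] by (simp add: bad_def D XY)
    also have "- (d * k) * \<eta>\<^sup>2 / 8 \<le> - (4 * ln n * k)"
      using mult_right_mono[OF ln, of "real k"] by (simp add: mult_ac)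
    then have "exp (- (d * k) * \<eta>\<^sup>2 / 8) \<le> exp (- (ln n * (4 * k)))" by (simp add: mult_ac)
    also have "\<dots> = 1 / exp (real (4 * k) * ln n)"
      by (simp add: exp_minus inverse_eq_divide mult_ac)
    also have "exp (real (4 * k) * ln n) = real n ^ (4 * k)"
      using n by (subst exp_of_nat_mult) simp
    finally show ?thesis .
  qed
  have card_pairs: "card (pairs k) \<le> n ^ (2 * k)" for k
  proof -
    have "card (pairs k) \<le> card ({X. X \<subseteq> {1..n} \<and> card X = k} \<times> {X. X \<subseteq> {1..n} \<and> card X = k})"
      by (rule card_mono) (auto simp: pairs_def)
    also have "\<dots> = (n choose k) * (n choose k)"
      by (simp add: card_cartesian_product n_subsets)
    also have "\<dots> \<le> n ^ k * n ^ k"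
      by (cases "k \<le> n") (auto simp: binomial_eq_0 intro: mult_mono binomial_le_pow)
    also have "\<dots> = n ^ (2 * k)" by (simp flip: power_add mult_2)
    finally show ?thesis .
  qed
  have "measure ?M (\<Union>k\<in>{1..n}. \<Union>(bad ` pairs k))
      \<le> (\<Sum>k\<in>{1..n}. measure ?M (\<Union>(bad ` pairs k)))"
    by (rule measure_pmf.finite_measure_subadditive_finite) auto
  also have "\<dots> \<le> (\<Sum>k\<in>{1..n}. \<Sum>XY\<in>pairs k. measure ?M (bad XY))"
    using fin by (intro sum_mono measure_pmf.finite_measure_subadditive_finite) auto
  also have "\<dots> \<le> (\<Sum>k\<in>{1..n}. \<Sum>XY\<in>pairs k. 1 / real n ^ (4 * k))"
    by (intro sum_mono prob_bad)
  also have "\<dots> \<le> (\<Sum>k\<in>{1..n}. 1 / real n ^ 2)"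
  proof (rule sum_mono)
    fix k assume k: "k \<in> {1..n}"
    have "real (card (pairs k)) / real n ^ (4 * k) \<le> real n ^ (2 * k) / real n ^ (4 * k)"
      using card_pairs[of k] by (intro divide_right_mono) (simp_all flip: of_nat_power)
    also have "\<dots> = 1 / real n ^ (2 * k)"
    proof -
      have "real n ^ (4 * k) = real n ^ (2 * k) * real n ^ (2 * k)" by (simp flip: power_add)
      then show ?thesis using n by simp
    qed
    also have "\<dots> \<le> 1 / real n ^ 2"
    proof (rule divide_left_mono)
      show "real n ^ 2 \<le> real n ^ (2 * k)" using n k by (intro power_increasing) auto
    qed (use n in auto)
    finally show "(\<Sum>XY\<in>pairs k. 1 / real n ^ (4 * k)) \<le> 1 / real n ^ 2" by simp
  qed
  also have "\<dots> = 1 / n" using n by (simp add: power2_eq_square)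
  finally have "measure ?M (\<Union>k\<in>{1..n}. \<Union>(bad ` pairs k)) \<le> 1 / n" .
  moreover have "- (\<Union>k\<in>{1..n}. \<Union>(bad ` pairs k)) \<subseteq> {G. locally_sparse {1..n} r d G}"
  proof
    fix G assume G: "G \<in> - (\<Union>k\<in>{1..n}. \<Union>(bad ` pairs k))"
    have "card (edges_between G X Y) < d * card X"
      if XY: "X \<subseteq> {1..n}" "Y \<subseteq> {1..n}" "X \<inter> Y = {}" "X \<noteq> {}" "card X = card Y" "2 * card X \<le> r"
      for X Y
    proof -
      have "finite X" using XY by (auto intro: finite_subset)
      then have "card X \<in> {1..n}"
        using XY card_mono[of "{1..n}" X] by (auto simp: Suc_le_eq card_gt_0_iff)
      moreover have "(X, Y) \<in> pairs (card X)" using XY by (simp add: pairs_def)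
      ultimately have "G \<notin> bad (X, Y)" using G by blast
      then show ?thesis by (simp add: bad_def not_le)
    qed
    then show "G \<in> {G. locally_sparse {1..n} r d G}" by (simp add: locally_sparse_def)
  qed
  then have "measure ?M (- (\<Union>k\<in>{1..n}. \<Union>(bad ` pairs k)))
      \<le> measure ?M {G. locally_sparse {1..n} r d G}"
    by (intro measure_pmf.finite_measure_mono) auto
  moreover have "measure ?M (- (\<Union>k\<in>{1..n}. \<Union>(bad ` pairs k)))
      = 1 - measure ?M (\<Union>k\<in>{1..n}. \<Union>(bad ` pairs k))"
    using measure_pmf.prob_compl[of "\<Union>k\<in>{1..n}. \<Union>(bad ` pairs k)" "gnp n p"]
    by (simp add: Compl_eq_Diff_UNIV)
  ultimately show ?thesis by linarith
qed

section \<open>Rainbow perfect matchings\<close>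

lemma card_neighbours:
  assumes "G \<subseteq> vertex_pairs V"
  shows "card {w. {v, w} \<in> G} = vertex_degree G v"
proof -
  have "bij_betw (\<lambda>w. {v, w}) {w. {v, w} \<in> G} {e \<in> G. v \<in> e}"
  proof (rule bij_betw_imageI)
    show "inj_on (\<lambda>w. {v, w}) {w. {v, w} \<in> G}"
      by (auto simp: inj_on_def doubleton_eq_iff)
    show "(\<lambda>w. {v, w}) ` {w. {v, w} \<in> G} = {e \<in> G. v \<in> e}"
    proof (intro equalityI subsetI)
      fix e assume e: "e \<in> {e \<in> G. v \<in> e}"
      then have "card e = 2" using assms by (auto simp: vertex_pairs_def)
      then obtain x y where "e = {x, y}" by (auto simp: card_2_iff)
      then have "\<exists>w. e = {v, w}" using e by auto
      then show "e \<in> (\<lambda>w. {v, w}) ` {w. {v, w} \<in> G}" using e by auto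
    qed auto
  qed
  then show ?thesis by (simp add: bij_betw_same_card vertex_degree_def)
qed

text \<open>The deterministic core: the first half of a good order \<open>\<sigma>\<close> assigns a vertex to each colour,
  and a perfect matching of the auxiliary bipartite graph \<open>E\<close> is rainbow, the edge at \<open>\<sigma> c\<close>
  having colour \<open>c\<close>.\<close>

theorem sparse_host_rainbow_perfect_matching:
  fixes d D \<delta> :: real and m :: nat and H :: "nat \<Rightarrow> nat set set"
  defines "V \<equiv> {1..2 * m}"
  assumes m: "0 < m" and G: "locally_sparse V (Suc m) d G" "G \<subseteq> vertex_pairs V"
    and H: "\<And>c. c \<in> {1..m} \<Longrightarrow> H c \<subseteq> G"
    and deg: "\<And>c. c \<in> {1..m} \<Longrightarrow> D \<le> min_degree V (H c)"
    and D: "0 \<le> D" and \<delta>: "0 \<le> \<delta>" "\<delta> \<le> 1" and d: "d \<le> (1 - \<delta>) * (D / 2)"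
    and few: "real ((2 * m)\<^sup>2 + 2 * m) * exp (- D * \<delta>\<^sup>2 / 20) < 1"
  shows "has_rainbow_perfect_matching V m H"
proof -
  define N where "N = (\<lambda>c v. {w. {v, w} \<in> H c})"
  have HV: "H c \<subseteq> vertex_pairs V" if "c \<in> {1..m}" for c using H G that by blast
  have N_V: "N c v \<subseteq> V" if "c \<in> {1..m}" for c v
    using HV[OF that] by (auto simp: N_def vertex_pairs_def)
  have N_deg: "D \<le> card (N c v)" if c: "c \<in> {1..m}" and v: "v \<in> V" for c v
  proof -
    have "min_degree V (H c) \<le> vertex_degree (H c) v"
      unfolding min_degree_def using v by (intro Min_le) (auto simp: V_def)
    also have "\<dots> = card (N c v)" unfolding N_def by (rule card_neighbours[OF HV[OF c], symmetric])
    finally show ?thesis using deg[OF c] by linarith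
  qed
  obtain \<sigma> where \<sigma>: "\<sigma> permutes V"
    and late: "\<And>c v. c \<in> {1..m} \<Longrightarrow> v \<in> V \<Longrightarrow> d \<le> card {j \<in> {m<..2 * m}. \<sigma> j \<in> N c v}"
    and early: "\<And>v. v \<in> V \<Longrightarrow> d \<le> card {c \<in> {1..m}. \<sigma> c \<in> N c v}"
    using random_order_keeps_degrees[OF m D \<delta> _ _ few, of N] N_V N_deg d
    unfolding V_def by (smt (verit))
  define A where "A = \<sigma> ` {1..m}"
  define B where "B = \<sigma> ` {m<..2 * m}"
  define E where "E = {(\<sigma> c, \<sigma> j) | c j. c \<in> {1..m} \<and> j \<in> {m<..2 * m} \<and> {\<sigma> c, \<sigma> j} \<in> H c}"
  have inj: "inj \<sigma>" using \<sigma> by (rule permutes_inj)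
  have split: "V = {1..m} \<union> {m<..2 * m}" by (auto simp: V_def)
  have AB: "A \<union> B = V"
    using permutes_image[OF \<sigma>] unfolding A_def B_def split by (simp add: image_Un)
  have disj: "A \<inter> B = {}" by (auto simp: A_def B_def dest!: injD[OF inj])
  have card_A: "card A = m" and card_B: "card B = m"
    using inj by (auto simp: A_def B_def card_image inj_on_subset)
  have "\<exists>f. bij_betw f A B \<and> (\<forall>a\<in>A. (a, f a) \<in> E)"
  proof (rule dense_subgraph_has_matching)
    show "locally_sparse V (Suc (card A)) d G" using G card_A by simp
    show "finite V" "A \<subseteq> V" "B \<subseteq> V" "A \<inter> B = {}" "card A = card B"
      using AB disj card_A card_B by (auto simp: V_def)
    show "a \<in> A \<and> b \<in> B \<and> {a, b} \<in> G" if "(a, b) \<in> E" for a b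
      using that H by (auto simp: E_def A_def B_def)
    show "d \<le> card (E `` {a})" if "a \<in> A" for a
    proof -
      obtain c where c: "c \<in> {1..m}" "a = \<sigma> c" using \<open>a \<in> A\<close> by (auto simp: A_def)
      have "E `` {a} = \<sigma> ` {j \<in> {m<..2 * m}. \<sigma> j \<in> N c (\<sigma> c)}"
        using c inj by (auto simp: E_def N_def inj_def)
      then show ?thesis
        using late[OF c(1), of a] c that AB inj by (auto simp: card_image inj_on_subset)
    qed
    show "d \<le> card (E\<inverse> `` {b})" if "b \<in> B" for b
    proof -
      obtain j where j: "j \<in> {m<..2 * m}" "b = \<sigma> j" using \<open>b \<in> B\<close> by (auto simp: B_def)
      have "E\<inverse> `` {b} = \<sigma> ` {c \<in> {1..m}. \<sigma> c \<in> N c b}"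
        using j inj by (auto simp: E_def N_def inj_def insert_commute)
      then show ?thesis
        using early[of b] that AB inj by (auto simp: card_image inj_on_subset)
    qed
  qed
  then obtain f where f: "bij_betw f A B" "\<And>a. a \<in> A \<Longrightarrow> (a, f a) \<in> E" by blast
  define F where "F = (\<lambda>a. {a, f a}) ` A"
  define \<psi> where "\<psi> = (\<lambda>c. {\<sigma> c, f (\<sigma> c)})"
  have fB: "f a \<in> B" if "a \<in> A" for a using f(1) that by (auto simp: bij_betw_def)
  have F_\<psi>: "F = \<psi> ` {1..m}" by (auto simp: F_def \<psi>_def A_def)
  have \<psi>_H: "\<psi> c \<in> H c" if "c \<in> {1..m}" for c
    using f(2)[of "\<sigma> c"] that by (auto simp: E_def A_def \<psi>_def dest!: injD[OF inj])
  have "perfect_matching V F"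
    unfolding perfect_matching_def
  proof (intro conjI)
    show "F \<subseteq> vertex_pairs V" using F_\<psi> \<psi>_H HV by blast
    have "disjnt {a, f a} {a', f a'}" if "a \<in> A" "a' \<in> A" "a \<noteq> a'" for a a'
      using that fB[of a] fB[of a'] disj f(1) by (auto simp: disjnt_def bij_betw_def inj_on_def)
    then show "pairwise disjnt F" unfolding F_def by (intro pairwise_imageI)
    have "\<Union>F = A \<union> f ` A" by (auto simp: F_def)
    then show "\<Union>F = V" using f(1) AB by (simp add: bij_betw_def)
  qed
  moreover have "rainbow m H F"
    unfolding rainbow_def
  proof (intro exI conjI ballI)
    show "inj_on (inv_into {1..m} \<psi>) F" unfolding F_\<psi> by (rule inj_on_inv_into) simp
    show "inv_into {1..m} \<psi> ` F \<subseteq> {1..m}" unfolding F_\<psi> by (auto intro: inv_into_into)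
    show "e \<in> H (inv_into {1..m} \<psi> e)" if "e \<in> F" for e
      using \<psi>_H[of "inv_into {1..m} \<psi> e"] that unfolding F_\<psi>
      by (metis f_inv_into_f inv_into_into)
  qed
  ultimately show ?thesis unfolding has_rainbow_perfect_matching_def by blast
qed

text \<open>The slack \<open>\<epsilon>\<close> is shared: the random order may lose a fraction \<open>\<epsilon> / 3\<close> of the degrees, which
  leaves \<open>d = (1/2 + \<epsilon>/2) * m * p\<close>, and the mean number of edges between small sets is less than
  \<open>d\<close> per vertex by a factor \<open>1 + \<epsilon>/2\<close>, the condition on \<open>m\<close> absorbing the rounding in
  \<open>Suc m\<close>. The constant 1080 is what the union bound for the random order needs, namely
  \<open>D * (\<epsilon>/3)\<^sup>2 / 20 \<ge> 3 * ln n\<close> with \<open>D \<ge> n * p / 2\<close>; the sparsity would need 512.\<close>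

lemma gnp_resilience_fixed_n:
  fixes \<epsilon> p :: real and m :: nat
  assumes \<epsilon>: "0 < \<epsilon>" "\<epsilon> < 1" and p: "0 \<le> p" "p \<le> 1" and m: "3 / \<epsilon> \<le> m"
    and np: "1080 / \<epsilon>\<^sup>2 * ln (real (2 * m)) \<le> real (2 * m) * p"
  shows "1 - 1 / real (2 * m) \<le> measure_pmf.prob (gnp (2 * m) p)
      {G. \<forall>H :: nat \<Rightarrow> nat set set.
        (\<forall>c\<in>{1..m}. H c \<subseteq> G \<and>
           real (min_degree {1..2 * m} (H c)) \<ge> (1/2 + \<epsilon>) * real (2 * m) * p)
        \<longrightarrow> has_rainbow_perfect_matching {1..2 * m} m H}" (is "_ \<le> measure_pmf.prob ?M ?good")
proof -
  define n where "n = 2 * m"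
  define d where "d = (1/2 + \<epsilon>/2) * (m * p)"
  define D where "D = (1/2 + \<epsilon>) * real n * p"
  have m3: "3 \<le> real m"
  proof -
    have "3 \<le> 3 / \<epsilon>" using \<epsilon> by (simp add: field_simps)
    then show ?thesis using m by linarith
  qed
  have np': "1080 * ln n \<le> n * p * \<epsilon>\<^sup>2"
    using np \<epsilon> by (simp add: n_def field_simps)
  have ln0: "0 \<le> ln (real n)" using m3 by (simp add: n_def)
  have np0: "0 \<le> n * p" using p by simp
  have "1 - 1 / real n \<le> measure_pmf.prob (gnp n p) {G. locally_sparse {1..n} (Suc m) d G}"
  proof (rule gnp_locally_sparse[where \<eta> = "\<epsilon> / 2"])
    have "(1 + \<epsilon> / 2) * Suc m \<le> (1 + \<epsilon>) * m"
    proof -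
      have "3 \<le> \<epsilon> * m" using m \<epsilon> by (simp add: field_simps)
      then show ?thesis using \<epsilon> by (simp add: algebra_simps add_divide_distrib)
    qed
    then have "(1 + \<epsilon> / 2) * Suc m * p \<le> (1 + \<epsilon>) * m * p" using p(1) by (rule mult_right_mono)
    then show "(1 + \<epsilon> / 2) * (real (Suc m) * p) \<le> 2 * d" by (simp add: d_def algebra_simps add_divide_distrib)
    have "4 * ln n \<le> n * p * \<epsilon>\<^sup>2 / 128" using np' ln0 by simp
    also have "\<dots> \<le> d * (\<epsilon> / 2)\<^sup>2 / 8"
    proof -
      have "n * p / 4 \<le> d" using p \<epsilon> by (simp add: d_def n_def algebra_simps)
      then have "n * p / 4 * (\<epsilon>\<^sup>2 / 32) \<le> d * (\<epsilon>\<^sup>2 / 32)" by (rule mult_right_mono) simp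
      then show ?thesis by (simp add: power2_eq_square)
    qed
    finally show "4 * ln n \<le> d * (\<epsilon> / 2)\<^sup>2 / 8" .
  qed (use p \<epsilon> m3 in \<open>auto simp: n_def\<close>)
  also have "\<dots> \<le> measure_pmf.prob ?M ?good"
    unfolding n_def
  proof (intro measure_pmf.finite_measure_mono_AE AE_pmfI impI)
    fix G assume G: "G \<in> set_pmf (gnp (2 * m) p)" "G \<in> {G. locally_sparse {1..2 * m} (Suc m) d G}"
    have "real ((2 * m)\<^sup>2 + 2 * m) * exp (- D * (\<epsilon> / 3)\<^sup>2 / 20) < 1"
    proof -
      have "n * p / 2 \<le> D" using p \<epsilon> by (simp add: D_def algebra_simps)
      then have "n * p / 2 * (\<epsilon>\<^sup>2 / 180) \<le> D * (\<epsilon>\<^sup>2 / 180)" by (rule mult_right_mono) simp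
      then have "3 * ln n \<le> D * (\<epsilon> / 3)\<^sup>2 / 20" using np' by (simp add: power2_eq_square mult_ac)
      then have "exp (- D * (\<epsilon> / 3)\<^sup>2 / 20) \<le> exp (- (3 * ln n))" by simp
      also have "\<dots> = 1 / real n ^ 3"
        using m3 exp_of_nat_mult[of 3 "ln (real n)"]
        by (simp add: exp_minus inverse_eq_divide n_def)
      finally have "real (n\<^sup>2 + n) * exp (- D * (\<epsilon> / 3)\<^sup>2 / 20) \<le> real (n\<^sup>2 + n) * (1 / real n ^ 3)"
        by (intro mult_left_mono) auto
      also have "\<dots> < 1"
      proof -
        have "n\<^sup>2 + n < n\<^sup>2 * 2" using m3 by (simp add: n_def power2_eq_square)
        also have "\<dots> \<le> n\<^sup>2 * n" using m3 by (intro mult_left_mono) (auto simp: n_def)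
        finally have "real (n\<^sup>2 + n) < real (n ^ 3)"
          unfolding of_nat_less_iff by (simp add: power2_eq_square power3_eq_cube)
        then show ?thesis using m3 by (simp add: n_def)
      qed
      finally show ?thesis by (simp add: n_def)
    qed
    moreover have "d \<le> (1 - \<epsilon> / 3) * (D / 2)"
    proof -
      have "0 \<le> m * p * (\<epsilon> * (1 - \<epsilon>) / 3)" using p \<epsilon> by simp
      then show ?thesis by (simp add: d_def D_def n_def field_simps power2_eq_square)
    qed
    moreover have "0 \<le> D" using p \<epsilon> by (simp add: D_def)
    ultimately show "G \<in> ?good"
      using sparse_host_rainbow_perfect_matching[of m d G _ D "\<epsilon> / 3"] G set_pmf_gnp m3 \<epsilon>
      by (auto simp: D_def n_def)
  qed auto
  finally show ?thesis by (simp add: n_def)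
qed

theorem theorem1p5:
  fixes \<epsilon> :: real and p :: "nat \<Rightarrow> real"
  assumes "0 < \<epsilon>" and "\<epsilon> < 1"
    and "\<And>n. even n \<Longrightarrow> 0 \<le> p n \<and> p n \<le> 1"
    and "p \<in> \<omega>[even_at_top](\<lambda>n. ln (real n) / real n)"
  shows "((\<lambda>n. measure_pmf.prob (gnp n (p n))
            {G. \<forall>H :: nat \<Rightarrow> nat set set.
                  (\<forall>c\<in>{1..n div 2}. H c \<subseteq> G \<and>
                     real (min_degree {1..n} (H c)) \<ge> (1/2 + \<epsilon>) * real n * p n)
                  \<longrightarrow> has_rainbow_perfect_matching {1..n} (n div 2) H})
          \<longlongrightarrow> 1) even_at_top"
    (is "(?P \<longlongrightarrow> 1) _")
proof (rule tendsto_sandwich)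
  have le: "even_at_top \<le> at_top" and even: "eventually even even_at_top"
    by (auto simp: even_at_top_def eventually_inf_principal)
  have large: "eventually (\<lambda>n::nat. 6 / \<epsilon> \<le> n \<and> 1 \<le> n) even_at_top"
    by (rule filter_leD[OF le]) (intro eventually_conj eventually_ge_at_top
      filterlim_real_sequentially[unfolded filterlim_at_top, rule_format])
  have "eventually (\<lambda>n. 1080 / \<epsilon>\<^sup>2 * norm (ln (real n) / real n) \<le> norm (p n)) even_at_top"
    using landau_omega.smallD[OF assms(4), of "1080 / \<epsilon>\<^sup>2"] assms(1) by simp
  with even large show "eventually (\<lambda>n. 1 - 1 / real n \<le> ?P n) even_at_top"
  proof eventually_elim
    case (elim n)
    then obtain m where n: "n = 2 * m" by (auto elim: evenE)
    have p: "0 \<le> p n" "p n \<le> 1" using assms(3) elim by auto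
    have "0 \<le> ln (real n)" using elim by simp
    then have "1080 / \<epsilon>\<^sup>2 * (ln (real n) / real n) \<le> p n" using elim p by simp
    then have "real n * (1080 / \<epsilon>\<^sup>2 * (ln (real n) / real n)) \<le> real n * p n"
      by (rule mult_left_mono) simp
    then have "1080 / \<epsilon>\<^sup>2 * ln (real n) \<le> real n * p n" using elim by simp
    then show ?case
      using gnp_resilience_fixed_n[OF assms(1,2) p, of m] elim by (simp add: n)
  qed
  show "eventually (\<lambda>n. ?P n \<le> 1) even_at_top" by simp
  have "((\<lambda>n. 1 - 1 / real n) \<longlongrightarrow> 1 - 0) at_top"
    by (intro tendsto_intros lim_1_over_n)
  then show "((\<lambda>n. 1 - 1 / real n) \<longlongrightarrow> 1) even_at_top"
    using le by (auto intro: tendsto_mono)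
qed auto

end
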